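(* Let $M\in\mathcal{LC}$ be given and let $\mathcal{M}_{\omega_M}=\{M^{(l)}:l>0\}$ be the matrix associated with $\omega_M$. Then the following are equivalent: $(a_R)$ $\exists\, A\ge 1\ \exists\, c\ge 1\ \forall\, x\in\mathbb{N}_{>0}\ \forall\, p\in\mathbb{N}_{>0}:\ \mu^{(x)}_p\le A\,(M^{(cx)}_p)^{1/p}$. $(b_R)$ $\mathcal{M}_{\omega_M}$ has the quotient/root comparison property of Roumieu type: $\forall\, x>0\ \exists\, y>0\ \exists\, A\ge 1\ \forall\, p\in\mathbb{N}_{>0}:\ \mu^{(x)}_p\le A\,(M^{(y)}_p)^{1/p}$. $(a_B)$ $\exists\, c\ge 1\ \forall\, x\in\mathbb{N}_{>0}\ \exists\, A\ge 1\ \forall\, p\in\mathbb{N}_{>0}:\ \mu^{(1/(cx))}_p\le A\,(M^{(1/x)}_p)^{1/p}$. $(b_B)$ $\mathcal{M}_{\omega_M}$ has the quotient/root comparison property of Beurling type: $\forall\, x>0\ \exists\, y>0\ \exists\, A\ge 1\ \forall\, p\in\mathbb{N}_{>0}:\ \mu^{(y)}_p\le A\,(M^{(x)}_p)^{1/p}$. $(c)$ $M$ satisfies $\exists\, d\in\mathbb{N}_{>0}\ \exists\, A\ge 1\ \forall\, p\in\mathbb{N}_{>0}:\ \mu_p\le A\,(M_{dp})^{1/(dp)}$.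
   Context: $\mathbb{N}=\{0,1,2,\dots\}$, $\mathbb{N}_{>0}=\{1,2,\dots\}$. $\mathcal{LC}$ denotes the set of all sequences $M=(M_p)_{p\in\mathbb{N}}$ of positive reals with $1=M_0\le M_1$, $M_p^2\le M_{p-1}M_{p+1}$ for all $p\ge1$, and $\lim_{p\to+\infty}(M_p)^{1/p}=+\infty$. Put $\mu_p:=M_p/M_{p-1}$ for $p\ge 1$, $\mu_0:=1$, and analogously $\mu^{(l)}_p:=M^{(l)}_p/M^{(l)}_{p-1}$, $\mu^{(l)}_0:=1$. Associated weight function: $\omega_M(t):=\sup_{p\in\mathbb{N}}\log(t^p/M_p)$ for $t>0$, $\omega_M(0):=0$. Associated weight matrix: with $\varphi_{\omega_M}(t):=\omega_M(e^t)$ and $\varphi^*_{\omega_M}(x):=\sup\{xy-\varphi_{\omega_M}(y):y\ge 0\}$ for $x\ge 0$, put $\mathcal{M}_{\omega_M}:=\{M^{(l)}:l>0\}$, $M^{(l)}_p:=\exp\big(\tfrac1l\varphi^*_{\omega_M}(lp)\big)$, $p\in\mathbb{N}$. *)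

theory Defs
  imports Complex_Main
begin

text \<open>The value at \<open>p = 0\<close> in the last condition is irrelevant for the limit.\<close>

definition LC :: "(nat \<Rightarrow> real) set" where
  "LC = {M. (\<forall>p. M p > 0) \<and> M 0 = 1 \<and> M 0 \<le> M 1 \<and>
            (\<forall>p\<ge>1. (M p)\<^sup>2 \<le> M (p - 1) * M (p + 1)) \<and>
            filterlim (\<lambda>p. root p (M p)) at_top at_top}"

definition quotients :: "(nat \<Rightarrow> real) \<Rightarrow> nat \<Rightarrow> real" where
  "quotients M p = (if p = 0 then 1 else M p / M (p - 1))"

text \<open>
  For \<open>M \<in> LC\<close> both suprema below are finite: \<open>t ^ p / M p\<close> tends to \<open>0\<close> as \<open>p\<close> grows, and
  \<open>assoc_weight M (exp y) \<ge> p * y - ln (M p)\<close> for every \<open>p\<close>. Hence they can be taken in \<^typ>\<open>real\<close>.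
\<close>

definition assoc_weight :: "(nat \<Rightarrow> real) \<Rightarrow> real \<Rightarrow> real" where
  "assoc_weight M t = (if t > 0 then SUP p. ln (t ^ p / M p) else 0)"

definition phi :: "(real \<Rightarrow> real) \<Rightarrow> real \<Rightarrow> real" where
  "phi \<omega> t = \<omega> (exp t)"

definition young_conj :: "(real \<Rightarrow> real) \<Rightarrow> real \<Rightarrow> real" where
  "young_conj \<phi> x = (SUP y\<in>{0..}. x * y - \<phi> y)"

text \<open>
  Weight matrices are represented as families indexed by a real \<open>l\<close>, of which only the
  members with \<open>l > 0\<close> are meaningful.
\<close>

definition weight_matrix :: "(real \<Rightarrow> real) \<Rightarrow> real \<Rightarrow> nat \<Rightarrow> real" where
  "weight_matrix \<omega> l p = exp (1 / l * young_conj (phi \<omega>) (l * real p))"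

definition quotient_root_Roumieu :: "(real \<Rightarrow> nat \<Rightarrow> real) \<Rightarrow> bool" where
  "quotient_root_Roumieu W \<longleftrightarrow>
     (\<forall>x>0. \<exists>y>0. \<exists>A\<ge>1. \<forall>p>0. quotients (W x) p \<le> A * root p (W y p))"

definition quotient_root_Beurling :: "(real \<Rightarrow> nat \<Rightarrow> real) \<Rightarrow> bool" where
  "quotient_root_Beurling W \<longleftrightarrow>
     (\<forall>x>0. \<exists>y>0. \<exists>A\<ge>1. \<forall>p>0. quotients (W y) p \<le> A * root p (W x p))"

definition quotient_root_seq :: "(nat \<Rightarrow> real) \<Rightarrow> bool" where
  "quotient_root_seq M \<longleftrightarrow>
     (\<exists>d::nat. d > 0 \<and> (\<exists>A\<ge>1. \<forall>p>0. quotients M p \<le> A * root (d * p) (M (d * p))))"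

end

theory Submission
  imports Defs
begin

text \<open>
  Write \<open>f\<close> for the Young conjugate of \<open>phi (assoc_weight M)\<close>. It interpolates \<open>ln M\<close>, lies above
  the lines through \<open>(n, ln (M n))\<close> with slope \<open>ln (M (n + 1) / M n)\<close>, and \<open>f t / t\<close> is
  nondecreasing. The quantities \<open>ln (quotients (W y) p)\<close> and \<open>ln (root p (W x p))\<close> are the slopes
  of \<open>f\<close> over \<open>[y (p - 1), y p]\<close> and over \<open>[0, x p]\<close>. Comparing slopes of \<open>f\<close> over arbitrary
  intervals with slopes over unit intervals, all four matrix conditions reduce to the condition on
  \<open>M\<close>: it yields \<open>A, c\<close> with \<open>quotients (W y) p \<le> A * root p (W (c * y) p)\<close> for all \<open>y > 0\<close>, and
  conversely it follows from \<open>quotients (W y) p \<le> A * root p (W x p)\<close> for a single pair \<open>x, y\<close>.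
\<close>

section \<open>Quotients and roots of the matrix in terms of the Young conjugate\<close>

lemma root_exp:
  assumes "p > 0"
  shows "root p (exp z) = exp (z / real p)"
  using assms by (intro real_root_pos_unique) (simp_all flip: exp_of_nat_mult)

lemma root_weight_matrix:
  assumes "p > 0"
  shows "root p (weight_matrix \<omega> x p) = exp (young_conj (phi \<omega>) (x * real p) / (x * real p))"
  using assms by (simp add: weight_matrix_def root_exp)

lemma quotients_weight_matrix:
  assumes "p > 0"
  shows "quotients (weight_matrix \<omega> y) p =
    exp ((young_conj (phi \<omega>) (y * real p) - young_conj (phi \<omega>) (y * (real p - 1))) / y)"
  using assms by (simp add: quotients_def weight_matrix_def of_nat_diff diff_divide_distrib flip: exp_diff)

section \<open>Log-convexity of sequences in \<open>LC\<close>\<close>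

context
  fixes M :: "nat \<Rightarrow> real"
  assumes M: "M \<in> LC"
begin

abbreviation (input) L :: "nat \<Rightarrow> real" where
  "L p \<equiv> ln (M p)"

abbreviation (input) D :: "nat \<Rightarrow> real" where
  "D p \<equiv> L (Suc p) - L p"

abbreviation (input) \<phi> :: "real \<Rightarrow> real" where
  "\<phi> \<equiv> phi (assoc_weight M)"

abbreviation (input) f :: "real \<Rightarrow> real" where
  "f \<equiv> young_conj (phi (assoc_weight M))"

lemma LC_pos: "M p > 0"
  using M by (simp add: LC_def)

lemma ln_LC_0: "L 0 = 0"
  using M by (simp add: LC_def)

lemma ln_quotient_mono:
  assumes "m \<le> n"
  shows "D m \<le> D n"
proof -
  have "D p \<le> D (Suc p)" for p
  proof -
    have "\<forall>q\<ge>1. (M q)\<^sup>2 \<le> M (q - 1) * M (q + 1)"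
      using M by (simp add: LC_def)
    from this[rule_format, of "Suc p"] have "(M (Suc p))\<^sup>2 \<le> M p * M (Suc (Suc p))"
      by simp
    then have "ln ((M (Suc p))\<^sup>2) \<le> ln (M p * M (Suc (Suc p)))"
      using LC_pos by (subst ln_le_cancel_iff) (simp_all add: less_imp_neq[symmetric])
    then show ?thesis
      using LC_pos[of p] LC_pos[of "Suc p"] LC_pos[of "Suc (Suc p)"]
      by (simp add: ln_mult ln_realpow)
  qed
  then show ?thesis
    using lift_Suc_mono_le[of D] assms by blast
qed

lemma ln_quotient_nonneg: "D n \<ge> 0"
proof -
  have "M 0 = 1" "M 1 \<ge> 1" using M by (auto simp: LC_def)
  then have "D 0 \<ge> 0" by simp
  then show ?thesis using ln_quotient_mono[of 0 n] by linarith
qed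

text \<open>\<open>L p - L n\<close> is, up to sign, a sum of increments \<open>D k\<close>. Those
  with \<open>k >= n\<close> are at least \<open>D n\<close> and those with \<open>k <= n\<close> at
  most \<open>D n\<close>, so the line stays below on both sides of \<open>n\<close>.\<close>

lemma ln_LC_supporting_line: "L p \<ge> L n + (real p - real n) * D n"
proof (cases "n \<le> p")
  case True
  then show ?thesis
  proof (induction p rule: dec_induct)
    case (step p)
    then show ?case
      using ln_quotient_mono[of n p] by (simp add: algebra_simps)
  qed simp
next
  case False
  then have "p \<le> n" by simp
  then show ?thesis
  proof (induction p rule: inc_induct)
    case (step p)
    then show ?case
      using ln_quotient_mono[of p n] by (simp add: algebra_simps)
  qed simp
qed

section \<open>The associated weight function\<close>

lemma ln_power_div_LC: "ln (exp y ^ p / M p) = real p * y - L p"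
  using LC_pos[of p] by (simp add: ln_div ln_realpow)

text \<open>Once \<open>root p (M p)\<close> exceeds \<open>exp y\<close> the terms are nonpositive,
  so only finitely many indices matter. The divergence of the roots enters here.\<close>

lemma bdd_above_assoc_weight: "bdd_above (range (\<lambda>p. ln (exp y ^ p / M p)))"
proof -
  have "eventually (\<lambda>p. exp y \<le> root p (M p)) at_top"
    using M by (simp add: LC_def filterlim_at_top)
  then obtain N where N: "\<And>p. p \<ge> N \<Longrightarrow> exp y \<le> root p (M p)"
    by (auto simp: eventually_at_top_linorder)
  have "ln (exp y ^ p / M p) \<le> 0" if "p \<ge> Suc N" for p
  proof -
    have "exp y ^ p \<le> root p (M p) ^ p"
      using N[of p] that by (intro power_mono) auto
    also have "\<dots> = M p"
      using that LC_pos[of p] by (intro real_root_pow_pos2) auto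
    finally show ?thesis
      using LC_pos[of p] by simp
  qed
  then have "range (\<lambda>p. ln (exp y ^ p / M p)) \<subseteq> (\<lambda>p. ln (exp y ^ p / M p)) ` {..N} \<union> {..0}"
    by (force simp: not_less_eq_eq)
  then show ?thesis
    by (rule bdd_above_mono[rotated]) simp
qed

lemma phi_eq: "\<phi> y = (SUP p. ln (exp y ^ p / M p))"
  by (simp add: phi_def assoc_weight_def)

lemma phi_ge: "\<phi> y \<ge> real p * y - L p"
  using cSUP_upper[OF UNIV_I bdd_above_assoc_weight, of y p] by (simp add: phi_eq ln_power_div_LC)

lemma phi_nonneg: "\<phi> y \<ge> 0"
  using phi_ge[of 0 y] ln_LC_0 by simp

text \<open>By the supporting line at \<open>n\<close>, the index \<open>n\<close> maximises
  \<open>p * D n - L p\<close>.\<close>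

lemma phi_ln_quotient_le: "\<phi> (D n) \<le> real n * D n - L n"
proof -
  have "ln (exp (D n) ^ p / M p) \<le> real n * D n - L n" for p
    unfolding ln_power_div_LC using ln_LC_supporting_line[of n p] by (simp add: algebra_simps)
  then show ?thesis
    unfolding phi_eq by (intro cSUP_least) auto
qed

section \<open>Slopes of the Young conjugate\<close>

lemma young_conj_ge:
  assumes "y \<ge> 0"
  shows "f t \<ge> t * y - \<phi> y"
proof -
  obtain n :: nat where n: "real n \<ge> t"
    using real_arch_simple by blast
  \<comment> \<open>As \<open>n >= t\<close> and \<open>z >= 0\<close>, replacing \<open>t\<close>
    by \<open>n\<close> only enlarges the left side.\<close>
  have "t * z - \<phi> z \<le> L n" if "z \<ge> 0" for z
    using mult_right_mono[OF n that] phi_ge[of n z] by linarith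
  then have "bdd_above ((\<lambda>z. t * z - \<phi> z) ` {0..})"
    by (auto simp: bdd_above_def)
  with assms show ?thesis
    unfolding young_conj_def by (intro cSUP_upper) auto
qed

lemma young_conj_leI:
  assumes "\<And>y. y \<ge> 0 \<Longrightarrow> t * y - \<phi> y \<le> c"
  shows "f t \<le> c"
  unfolding young_conj_def using assms by (intro cSUP_least) auto

text \<open>Test the supremum at \<open>y = D n\<close>, which is admissible because it is
  nonnegative.\<close>

lemma young_conj_supporting_line: "f t \<ge> L n + (t - real n) * D n"
  using young_conj_ge[OF ln_quotient_nonneg, of t n] phi_ln_quotient_le[of n]
  by (simp add: algebra_simps)

lemma young_conj_of_nat: "f (real n) = L n"
proof (rule antisym)
  show "f (real n) \<le> L n"
    using phi_ge by (intro young_conj_leI) (simp add: algebra_simps)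
  show "f (real n) \<ge> L n"
    using young_conj_supporting_line[of n "real n"] by simp
qed

text \<open>Each \<open>y\<close> in the supremum for \<open>f b\<close> is treated separately. If
  \<open>y <= D n\<close>, moving from \<open>b\<close> to \<open>a\<close> costs at most
  \<open>(b - a) * D n\<close>. If \<open>y > D n\<close>, moving from \<open>b\<close> up to
  \<open>n\<close> gains enough to compare with the supporting line at \<open>n\<close>.\<close>

lemma young_conj_slope_le:
  assumes "a \<le> b" "b \<le> real n"
  shows "f b - f a \<le> (b - a) * D n"
proof -
  have "b * y - \<phi> y \<le> f a + (b - a) * D n" if y: "y \<ge> 0" for y
  proof (cases "y \<le> D n")
    case True
    then have "(b - a) * y \<le> (b - a) * D n"
      using assms by (intro mult_left_mono) auto
    then show ?thesis
      using young_conj_ge[OF y, of a] by (simp add: algebra_simps)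
  next
    case False
    then have "(real n - b) * D n \<le> (real n - b) * y"
      using assms by (intro mult_left_mono) auto
    then show ?thesis
      using young_conj_supporting_line[of n a] phi_ge[of n y] by (simp add: algebra_simps)
  qed
  from young_conj_leI[OF this] show ?thesis
    by simp
qed

text \<open>Mirror image of \<open>young_conj_slope_le\<close>: small \<open>y\<close> are compared
  with the line at \<open>n\<close>, large \<open>y\<close> with the value at
  \<open>b\<close>.\<close>

lemma young_conj_slope_ge:
  assumes "real n \<le> a" "a \<le> b"
  shows "(b - a) * D n \<le> f b - f a"
proof -
  have "a * y - \<phi> y \<le> f b - (b - a) * D n" if y: "y \<ge> 0" for y
  proof (cases "y \<le> D n")
    case True
    then have "(a - real n) * y \<le> (a - real n) * D n"
      using assms by (intro mult_left_mono) auto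
    then show ?thesis
      using young_conj_supporting_line[of n b] phi_ge[of n y] by (simp add: algebra_simps)
  next
    case False
    then have "(b - a) * D n \<le> (b - a) * y"
      using assms by (intro mult_left_mono) auto
    then show ?thesis
      using young_conj_ge[OF y, of b] by (simp add: algebra_simps)
  qed
  from young_conj_leI[OF this] show ?thesis
    by simp
qed

text \<open>Dividing \<open>s * y - \<phi> y\<close> by \<open>s\<close> leaves
  \<open>y - \<phi> y / s\<close>, which grows with \<open>s\<close> since \<open>\<phi>\<close> is
  nonnegative.\<close>

lemma young_conj_div_mono:
  assumes "0 < s" "s \<le> t"
  shows "f s / s \<le> f t / t"
proof -
  have "s * y - \<phi> y \<le> s * (f t / t)" if y: "y \<ge> 0" for y
  proof -
    have "t * (s * y) - t * \<phi> y \<le> s * (t * y - \<phi> y)"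
      using mult_right_mono[OF assms(2) phi_nonneg[of y]] by (simp add: algebra_simps)
    also have "\<dots> \<le> s * f t"
      using young_conj_ge[OF y, of t] assms by (intro mult_left_mono) auto
    finally show ?thesis
      using assms by (simp add: field_simps)
  qed
  from young_conj_leI[OF this] show ?thesis
    using assms by (simp add: field_simps)
qed

lemma young_conj_nonneg:
  assumes "t \<ge> 0"
  shows "f t \<ge> 0"
  using young_conj_supporting_line[of 0 t] ln_LC_0 mult_nonneg_nonneg[OF assms ln_quotient_nonneg[of 0]]
  by simp

section \<open>Transfer between the sequence and the matrix\<close>

lemma quotients_LC: "quotients M (Suc n) = exp (D n)"
  using LC_pos by (simp add: quotients_def exp_diff)

lemma root_LC:
  assumes "n > 0"
  shows "root n (M n) = exp (f (real n) / real n)"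
  using root_exp[OF assms, of "L n"] LC_pos[of n] by (simp add: young_conj_of_nat)

lemma quotient_root_matrix:
  assumes "quotient_root_seq M"
  obtains A c where "A \<ge> 1" "c \<ge> 1"
    "\<And>y p. y > 0 \<Longrightarrow> p > 0 \<Longrightarrow> quotients (weight_matrix (assoc_weight M) y) p
       \<le> A * root p (weight_matrix (assoc_weight M) (c * y) p)"
proof -
  obtain d :: nat and A where d: "d > 0" and A: "A \<ge> 1"
    and c: "\<And>p. p > 0 \<Longrightarrow> quotients M p \<le> A * root (d * p) (M (d * p))"
    using assms by (auto simp: quotient_root_seq_def)
  have main: "D n \<le> ln A + f (real (d * Suc n)) / real (d * Suc n)" for n
  proof -
    have "exp (D n) \<le> exp (ln A) * exp (f (real (d * Suc n)) / real (d * Suc n))"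
      using c[of "Suc n"] d A by (simp add: quotients_LC root_LC del: of_nat_mult of_nat_Suc mult_Suc_right)
    then show ?thesis by (simp flip: exp_add)
  qed
  \<comment> \<open>The summand \<open>D 1\<close> takes care of \<open>y * p < 1\<close>, where the
    ceiling \<open>n\<close> below is at most 1.\<close>
  define B where "B = ln A + D 1"
  show thesis
  proof (rule that)
    show "exp B \<ge> 1"
      using A ln_quotient_nonneg[of 1] by (simp add: B_def)
    \<comment> \<open>The factor 3 comes from \<open>n + 1 < y * p + 2 <= 3 * y * p\<close> when
      \<open>y * p >= 1\<close>.\<close>
    show "3 * real d \<ge> 1" using d by simp
    fix y :: real and p :: nat
    assume y: "y > 0" and p: "p > 0"
    define n where "n = nat \<lceil>y * real p\<rceil>"
    have yp: "y * real p > 0" using y p by simp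
    have n: "y * real p \<le> real n" "real n < y * real p + 1"
      using yp unfolding n_def by linarith+
    have slope: "(f (y * real p) - f (y * (real p - 1))) / y \<le> D n"
      using young_conj_slope_le[of "y * (real p - 1)" "y * real p" n] n y
      by (simp add: field_simps)
    have "D n \<le> B + f (3 * real d * y * real p) / (3 * real d * y * real p)"
    proof (cases "y * real p \<ge> 1")
      case True
      have "real (d * Suc n) = real d * (real n + 1)" by (simp add: algebra_simps)
      also have "\<dots> \<le> real d * (3 * (y * real p))"
        using n True by (intro mult_left_mono) auto
      also have "\<dots> = 3 * real d * y * real p" by simp
      finally have "f (real (d * Suc n)) / real (d * Suc n)
          \<le> f (3 * real d * y * real p) / (3 * real d * y * real p)"
        using d by (intro young_conj_div_mono) (simp_all only: of_nat_0_less_iff nat_0_less_mult_iff zero_less_Suc simp_thms)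
      then show ?thesis
        using main[of n] ln_quotient_nonneg[of 1] unfolding B_def by linarith
    next
      case False
      with n have "n \<le> 1" by linarith
      then have "D n \<le> D 1" by (rule ln_quotient_mono)
      moreover have "f (3 * real d * y * real p) / (3 * real d * y * real p) \<ge> 0"
        using y by (intro divide_nonneg_nonneg young_conj_nonneg) auto
      ultimately show ?thesis
        using A unfolding B_def by (smt (verit) ln_ge_zero)
    qed
    with slope show "quotients (weight_matrix (assoc_weight M) y) p
       \<le> exp B * root p (weight_matrix (assoc_weight M) (3 * real d * y) p)"
      using p by (simp add: quotients_weight_matrix root_weight_matrix flip: exp_add)
  qed
qed

lemma quotient_root_seqI:
  assumes x: "x > 0" and y: "y > 0" and A: "A \<ge> 1"
    and le: "\<And>p. p > 0 \<Longrightarrow> quotients (weight_matrix (assoc_weight M) y) p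
       \<le> A * root p (weight_matrix (assoc_weight M) x p)"
  shows "quotient_root_seq M"
proof -
  \<comment> \<open>The \<open>p\<close> chosen below satisfies
    \<open>p < n / y + 2 <= (1 / y + 2) * q\<close>, so this \<open>d\<close> gives
    \<open>x * p <= d * q\<close>, as the monotonicity of \<open>f t / t\<close> requires.\<close>
  define d where "d = nat \<lceil>x * (1 / y + 2)\<rceil>"
  have d: "x * (1 / y + 2) \<le> real d"
    unfolding d_def by linarith
  have "x * (1 / y + 2) > 0" using x y by (simp add: add_pos_pos)
  then have d0: "d > 0" using d by linarith
  have "quotients M q \<le> A * root (d * q) (M (d * q))" if "q > 0" for q
  proof -
    from that obtain n where q: "q = Suc n" by (cases q) auto
    \<comment> \<open>The shift by one puts the left endpoint \<open>y * (p - 1)\<close> of the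
      matrix interval at or beyond \<open>n\<close>.\<close>
    define p where "p = Suc (nat \<lceil>real n / y\<rceil>)"
    have "real n / y \<ge> 0" using y by simp
    then have p: "real n / y \<le> real p - 1" "real p < real n / y + 2" and p0: "p > 0"
      unfolding p_def by linarith+
    from p(1) have np: "real n \<le> y * (real p - 1)"
      using y by (simp add: field_simps)
    have "D n \<le> (f (y * real p) - f (y * (real p - 1))) / y"
      using young_conj_slope_ge[OF np, of "y * real p"] y by (simp add: field_simps)
    also have "\<dots> \<le> ln A + f (x * real p) / (x * real p)"
    proof -
      have "exp ((f (y * real p) - f (y * (real p - 1))) / y) \<le> exp (ln A) * exp (f (x * real p) / (x * real p))"
        using le[OF p0] p0 A by (simp add: quotients_weight_matrix root_weight_matrix)
      then show ?thesis by (simp flip: exp_add)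
    qed
    also have "\<dots> \<le> ln A + f (real (d * q)) / real (d * q)"
    proof -
      have "real p \<le> (1 / y + 2) * real q"
        using p(2) y by (simp add: q field_simps) (smt (verit) mult_nonneg_nonneg of_nat_0_le_iff)
      then have "x * real p \<le> x * (1 / y + 2) * real q"
        using x by (simp add: mult.assoc)
      also have "\<dots> \<le> real d * real q"
        using d by (intro mult_right_mono) auto
      finally show ?thesis
        using x p0 young_conj_div_mono[of "x * real p" "real (d * q)"] by simp
    qed
    finally have "exp (D n) \<le> exp (ln A + f (real (d * q)) / real (d * q))"
      by simp
    then show ?thesis
      using A d0 that quotients_LC[of n] root_LC[of "d * q"] by (simp add: exp_add q)
  qed
  then show ?thesis
    using A d0 by (auto simp: quotient_root_seq_def)
qed

end

theorem proposition4p4: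
  fixes M :: "nat \<Rightarrow> real" and W :: "real \<Rightarrow> nat \<Rightarrow> real"
  assumes "M \<in> LC"
  defines "W \<equiv> weight_matrix (assoc_weight M)"
  shows
    "((\<exists>A\<ge>1. \<exists>c\<ge>1. \<forall>x::nat. x > 0 \<longrightarrow> (\<forall>p>0.
         quotients (W (real x)) p \<le> A * root p (W (c * real x) p)))
        \<longleftrightarrow> quotient_root_seq M)
     \<and> (quotient_root_Roumieu W \<longleftrightarrow> quotient_root_seq M)
     \<and> ((\<exists>c\<ge>1. \<forall>x::nat. x > 0 \<longrightarrow> (\<exists>A\<ge>1. \<forall>p>0.
         quotients (W (1 / (c * real x))) p \<le> A * root p (W (1 / real x) p)))
        \<longleftrightarrow> quotient_root_seq M)
     \<and> (quotient_root_Beurling W \<longleftrightarrow> quotient_root_seq M)"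
    (is "(?aR \<longleftrightarrow> _) \<and> (_ \<longleftrightarrow> _) \<and> (?aB \<longleftrightarrow> _) \<and> _")
proof -
  have seqI: "quotient_root_seq M"
    if "x > 0" "y > 0" "A \<ge> 1" "\<And>p. p > 0 \<Longrightarrow> quotients (W y) p \<le> A * root p (W x p)" for x y A
    using quotient_root_seqI[OF assms(1) that(1-3)] that(4) unfolding W_def by blast
  \<comment> \<open>Since \<open>seqI\<close> asks for a single pair of parameters, each condition
    is used only at its outer value 1.\<close>
  have aR: "quotient_root_seq M" if ?aR
  proof -
    from that obtain A c where "A \<ge> 1" "c \<ge> 1"
      "\<And>x p::nat. x > 0 \<Longrightarrow> p > 0 \<Longrightarrow> quotients (W (real x)) p \<le> A * root p (W (c * real x) p)"
      by blast
    from this(1,2) this(3)[of 1] show ?thesis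
      by (intro seqI[of c 1 A]) auto
  qed
  have bR: "quotient_root_seq M" if "quotient_root_Roumieu W"
    using that zero_less_one[where 'a = real] unfolding quotient_root_Roumieu_def by (meson seqI)
  have aB: "quotient_root_seq M" if ?aB
  proof -
    from that obtain c where c: "c \<ge> 1"
      "\<And>x::nat. x > 0 \<Longrightarrow> \<exists>A\<ge>1. \<forall>p>0. quotients (W (1 / (c * real x))) p \<le> A * root p (W (1 / real x) p)"
      by blast
    from c(2)[of 1] obtain A where "A \<ge> 1" "\<And>p. p > 0 \<Longrightarrow> quotients (W (1 / c)) p \<le> A * root p (W 1 p)"
      by auto
    with c(1) show ?thesis
      by (intro seqI[of 1 "1 / c" A]) auto
  qed
  have bB: "quotient_root_seq M" if "quotient_root_Beurling W"
    using that zero_less_one[where 'a = real] unfolding quotient_root_Beurling_def by (meson seqI)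
  have "?aR \<and> quotient_root_Roumieu W \<and> ?aB \<and> quotient_root_Beurling W" if seq: "quotient_root_seq M"
  proof -
    obtain A c where A: "A \<ge> 1" and c: "c \<ge> 1"
      and le: "\<And>y p. y > 0 \<Longrightarrow> p > 0 \<Longrightarrow> quotients (W y) p \<le> A * root p (W (c * y) p)"
      using quotient_root_matrix[OF assms(1) seq] unfolding W_def by blast
    \<comment> \<open>As \<open>c\<close> is uniform in \<open>y\<close>, rescaling moves it to the
      quotient side, which is the Beurling form.\<close>
    have le': "quotients (W (x / c)) p \<le> A * root p (W x p)" if "x > 0" "p > 0" for x p
      using le[of "x / c" p] that c by simp
    have ?aR
      using A c le by (metis of_nat_0_less_iff)
    moreover have "quotient_root_Roumieu W"
      unfolding quotient_root_Roumieu_def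
    proof (intro allI impI)
      fix x :: real assume "x > 0"
      with A c le[of x] show "\<exists>y>0. \<exists>A\<ge>1. \<forall>p>0. quotients (W x) p \<le> A * root p (W y p)"
        by (intro exI[of _ "c * x"] conjI exI[of _ A]) auto
    qed
    moreover have ?aB
    proof (rule exI[of _ c], intro conjI allI impI)
      fix x :: nat assume "x > 0"
      then have "\<forall>p>0. quotients (W (1 / (c * real x))) p \<le> A * root p (W (1 / real x) p)"
        using le'[of "1 / real x"] by (simp add: mult.commute)
      with A show "\<exists>A\<ge>1. \<forall>p>0. quotients (W (1 / (c * real x))) p \<le> A * root p (W (1 / real x) p)"
        by blast
    qed (use c in auto)
    moreover have "quotient_root_Beurling W"
      unfolding quotient_root_Beurling_def
    proof (intro allI impI)
      fix x :: real assume "x > 0"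
      with A c le'[of x] show "\<exists>y>0. \<exists>A\<ge>1. \<forall>p>0. quotients (W y) p \<le> A * root p (W x p)"
        by (intro exI[of _ "x / c"] conjI exI[of _ A]) auto
    qed
    ultimately show ?thesis by blast
  qed
  with aR bR aB bB show ?thesis by blast
qed

end
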